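(* Let $n\ge 2$ and $K\ge 1$ be integers, let $\varepsilon>0$, $\rho\in(0,1]$ and $\gamma\ge 0$, and let $y_1,\dots,y_K\in\mathbb{R}^{n-1}$ satisfy $\sum_{k=1}^K y_ky_k^\top\succ 0$. For real symmetric positive definite $(n-1)\times(n-1)$ matrices $\Sigma$ define $$F_\gamma(\Sigma)=\frac{1}{1+\gamma/(n-1)}\left(\frac{n-1}{K}\sum_{k=1}^K\frac{y_ky_k^\top}{y_k^\top\Sigma^{-1}y_k+\varepsilon}+\frac{\gamma}{\mathrm{tr}(\Sigma^{-1})}I\right),$$ $$\widetilde M(\Sigma)=(1-\rho)F_\gamma(\Sigma)+\rho I,\qquad M(\Sigma)=\frac{(n-1)\,\widetilde M(\Sigma)}{\mathrm{tr}(\widetilde M(\Sigma))}.$$ Then the mapping $M$ admits at least one fixed point $\Sigma_\star\succ 0$ with $\mathrm{tr}(\Sigma_\star)=n-1$, i.e. $M(\Sigma_\star)=\Sigma_\star$.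
   Context: $\succ 0$ means symmetric positive definite; $I$ is the $(n-1)\times(n-1)$ identity matrix. *)

theory Defs
  imports "HOL-Analysis.Analysis"
begin

definition sym_pos_def :: "real^'m^'m \<Rightarrow> bool" where
  "sym_pos_def A \<longleftrightarrow> transpose A = A \<and> (\<forall>x. x \<noteq> 0 \<longrightarrow> 0 < x \<bullet> (A *v x))"

definition outer_prod :: "real^'m \<Rightarrow> real^'m^'m" where
  "outer_prod y = (\<chi> i j. y $ i * y $ j)"

text \<open>In the following maps \<open>n\<close> is the number with \<open>CARD('m) = n - 1\<close>. They are meant for
  symmetric positive definite \<open>S\<close>; elsewhere \<open>matrix_inv\<close> and division by zero give them junk values.\<close>

definition F_map ::
  "nat \<Rightarrow> nat \<Rightarrow> real \<Rightarrow> real \<Rightarrow> (nat \<Rightarrow> real^'m) \<Rightarrow> real^'m^'m \<Rightarrow> real^'m^'m" where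
  "F_map n K \<epsilon> \<gamma> y S =
     (1 / (1 + \<gamma> / (real n - 1))) *\<^sub>R
       (((real n - 1) / real K) *\<^sub>R
          (\<Sum>k=1..K. (1 / (y k \<bullet> (matrix_inv S *v y k) + \<epsilon>)) *\<^sub>R outer_prod (y k))
        + (\<gamma> / trace (matrix_inv S)) *\<^sub>R mat 1)"

definition M_tilde ::
  "nat \<Rightarrow> nat \<Rightarrow> real \<Rightarrow> real \<Rightarrow> real \<Rightarrow> (nat \<Rightarrow> real^'m) \<Rightarrow> real^'m^'m \<Rightarrow> real^'m^'m" where
  "M_tilde n K \<epsilon> \<rho> \<gamma> y S = (1 - \<rho>) *\<^sub>R F_map n K \<epsilon> \<gamma> y S + \<rho> *\<^sub>R mat 1"

definition M_map ::
  "nat \<Rightarrow> nat \<Rightarrow> real \<Rightarrow> real \<Rightarrow> real \<Rightarrow> (nat \<Rightarrow> real^'m) \<Rightarrow> real^'m^'m \<Rightarrow> real^'m^'m" where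
  "M_map n K \<epsilon> \<rho> \<gamma> y S =
     ((real n - 1) / trace (M_tilde n K \<epsilon> \<rho> \<gamma> y S)) *\<^sub>R M_tilde n K \<epsilon> \<rho> \<gamma> y S"

end

theory Submission
  imports Defs
begin

text \<open>Brouwer's theorem applies to a map of the form \<open>S \<mapsto> (d / trace (G S)) G S\<close>, where on positive
  definite matrices of trace \<open>d\<close> the map \<open>G\<close> satisfies \<open>G S \<ge> r I\<close> and \<open>trace (G S) \<le> B\<close>: the image
  then lies in the compact convex set of matrices \<open>\<ge> (r d / B) I\<close> of trace \<open>d\<close>, and the map sends
  that set into itself. For \<open>M_tilde\<close> the shrinkage term gives \<open>r = \<rho>\<close>. The trace is bounded because
  \<open>\<epsilon> > 0\<close> bounds the rank-one terms, while the Cauchy-Schwarz inequality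
  \<open>d\<^sup>2 \<le> trace S * trace (S\<^sup>-\<^sup>1)\<close> bounds the remaining one.\<close>

lemma transpose_add: "transpose (A + B) = transpose A + transpose B"
  by (simp add: transpose_def vec_eq_iff)

lemma transpose_diff: "transpose (A - B) = transpose A - transpose B"
  by (simp add: transpose_def vec_eq_iff)

lemma trace_scaleR: "trace (a *\<^sub>R A) = a *\<^sub>R trace (A :: 'a::{real_vector,semiring_1}^'n^'n)"
  by (simp add: trace_def scaleR_sum_right)

lemma trace_sum: "trace (\<Sum>k\<in>I. f k) = (\<Sum>k\<in>I. trace (f k :: 'a::semiring_1^'n^'n))"
  by (simp add: trace_def sum.swap[of _ I])

lemma matrix_nth_eq_inner_axis: "(A :: real^'n^'m) $ i $ j = axis i 1 \<bullet> (A *v axis j 1)"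
  by (simp add: inner_axis' matrix_vector_mult_basis column_def)

lemma inner_matrix_vector_mult_symmetric:
  fixes A :: "real^'n^'n"
  assumes "transpose A = A"
  shows "x \<bullet> (A *v y) = (A *v x) \<bullet> y"
  using dot_lmul_matrix[of x A y] assms by (metis transpose_matrix_vector)

lemma continuous_on_matrix_vector_mult [continuous_intros]:
  fixes f :: "'a::topological_space \<Rightarrow> 'b::real_normed_algebra_1^'n^'m"
  assumes "continuous_on T f" and "continuous_on T g"
  shows "continuous_on T (\<lambda>t. f t *v g t)"
  unfolding matrix_vector_mult_def by (intro continuous_intros assms)

lemma continuous_on_trace [continuous_intros]:
  fixes f :: "'a::topological_space \<Rightarrow> 'b::real_normed_algebra_1^'n^'n"
  assumes "continuous_on T f"
  shows "continuous_on T (\<lambda>t. trace (f t))"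
  unfolding trace_def by (intro continuous_intros assms)

lemma continuous_on_transpose [continuous_intros]:
  fixes f :: "'a::topological_space \<Rightarrow> 'b::topological_space^'n^'m"
  assumes "continuous_on T f"
  shows "continuous_on T (\<lambda>t. transpose (f t))"
  unfolding transpose_def by (intro continuous_intros assms)

lemma continuous_on_det [continuous_intros]:
  fixes f :: "'a::topological_space \<Rightarrow> 'b::real_normed_field^'n^'n"
  assumes "continuous_on T f"
  shows "continuous_on T (\<lambda>t. det (f t))"
  unfolding det_def by (intro continuous_intros assms)

lemma matrix_inv_right: "invertible A \<Longrightarrow> A ** matrix_inv A = mat 1"
  unfolding invertible_def matrix_inv_def by (drule someI_ex) simp

lemma matrix_inv_right_vector: "invertible A \<Longrightarrow> A *v (matrix_inv A *v x) = x"
  by (simp add: matrix_vector_mul_assoc matrix_inv_right)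

lemma matrix_inv_eq_det_quotient:
  fixes A :: "'a::field^'n^'n"
  assumes "invertible A"
  shows "matrix_inv A =
    (\<chi> i j. det (\<chi> k l. if l = i then axis j 1 $ k else A $ k $ l) / det A)"
proof -
  have "matrix_inv A *v axis j 1 =
      (\<chi> i. det (\<chi> k l. if l = i then axis j 1 $ k else A $ k $ l) / det A)" for j
    using matrix_inv_right_vector[OF assms, of "axis j 1"] assms
    by (simp add: cramer invertible_det_nz)
  moreover have "(matrix_inv A *v axis j 1) $ i = matrix_inv A $ i $ j" for i j
    by (simp add: matrix_vector_mult_def axis_def if_distrib cong: if_cong)
  ultimately show ?thesis
    by (simp add: vec_eq_iff)
qed

lemma continuous_on_matrix_inv [continuous_intros]:
  fixes f :: "'a::topological_space \<Rightarrow> 'b::real_normed_field^'n^'n"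
  assumes "continuous_on T f" and inv: "\<And>t. t \<in> T \<Longrightarrow> invertible (f t)"
  shows "continuous_on T (\<lambda>t. matrix_inv (f t))"
proof -
  have "continuous_on T (\<lambda>t. if l = i then axis j 1 $ k else f t $ k $ l)" for i j k l
    by (cases "l = i") (auto intro!: continuous_intros assms(1))
  then have "continuous_on T (\<lambda>t. (\<chi> i j.
      det (\<chi> k l. if l = i then axis j 1 $ k else f t $ k $ l) / det (f t)) :: 'b^'n^'n)"
    by (intro continuous_intros assms(1)) (use inv in \<open>auto simp: invertible_det_nz\<close>)
  then show ?thesis
    by (rule continuous_on_eq) (simp add: inv matrix_inv_eq_det_quotient)
qed

lemma transpose_outer_prod: "transpose (outer_prod y) = outer_prod y"
  by (simp add: transpose_def outer_prod_def vec_eq_iff mult.commute)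

lemma trace_outer_prod: "trace (outer_prod y) = y \<bullet> y"
  by (simp add: trace_def outer_prod_def inner_vec_def)

lemma outer_prod_mult_vec: "outer_prod y *v x = (y \<bullet> x) *\<^sub>R y"
  by (simp add: outer_prod_def matrix_vector_mult_def inner_vec_def vec_eq_iff sum_distrib_left
      sum_distrib_right mult_ac)

definition sym_pos_semidef :: "real^'m^'m \<Rightarrow> bool" where
  "sym_pos_semidef A \<longleftrightarrow> transpose A = A \<and> (\<forall>x. 0 \<le> x \<bullet> (A *v x))"

lemma sym_pos_def_imp_semidef: "sym_pos_def A \<Longrightarrow> sym_pos_semidef A"
  unfolding sym_pos_def_def sym_pos_semidef_def by (metis inner_zero_left less_eq_real_def)

lemma sym_pos_semidef_inner_nonneg: "sym_pos_semidef A \<Longrightarrow> 0 \<le> x \<bullet> (A *v x)"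
  by (simp add: sym_pos_semidef_def)

lemma sym_pos_semidef_add:
  "\<lbrakk>sym_pos_semidef A; sym_pos_semidef B\<rbrakk> \<Longrightarrow> sym_pos_semidef (A + B)"
  by (simp add: sym_pos_semidef_def transpose_add matrix_vector_mult_add_rdistrib inner_add_right)

lemma sym_pos_semidef_scaleR:
  "\<lbrakk>0 \<le> a; sym_pos_semidef A\<rbrakk> \<Longrightarrow> sym_pos_semidef (a *\<^sub>R A)"
  by (simp add: sym_pos_semidef_def transpose_scalar scaleR_matrix_vector_assoc[symmetric])

lemma sym_pos_semidef_mat_1: "sym_pos_semidef (mat 1)"
  by (simp add: sym_pos_semidef_def)

lemma sym_pos_semidef_sum:
  assumes "\<And>k. k \<in> I \<Longrightarrow> sym_pos_semidef (f k)"
  shows "sym_pos_semidef (\<Sum>k\<in>I. f k)"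
proof -
  have zero: "sym_pos_semidef 0"
    using sym_pos_semidef_scaleR[OF order_refl sym_pos_semidef_mat_1] by simp
  show ?thesis
    using assms
    by (induction I rule: infinite_finite_induct) (simp_all add: zero sym_pos_semidef_add)
qed

lemma sym_pos_semidef_outer_prod: "sym_pos_semidef (outer_prod y)"
  by (simp add: sym_pos_semidef_def transpose_outer_prod outer_prod_mult_vec inner_commute)

lemma sym_pos_semidef_diag_nonneg: "sym_pos_semidef A \<Longrightarrow> 0 \<le> A $ i $ i"
  unfolding matrix_nth_eq_inner_axis by (rule sym_pos_semidef_inner_nonneg)

lemma sym_pos_semidef_trace_nonneg: "sym_pos_semidef A \<Longrightarrow> 0 \<le> trace A"
  unfolding trace_def by (intro sum_nonneg sym_pos_semidef_diag_nonneg)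

lemma sym_pos_semidef_abs_nth_le:
  assumes "sym_pos_semidef A"
  shows "\<bar>A $ i $ j\<bar> \<le> (A $ i $ i + A $ j $ j) / 2"
proof -
  have "transpose A $ i $ j = A $ i $ j"
    using assms by (simp only: sym_pos_semidef_def)
  then have "A $ j $ i = A $ i $ j"
    by (simp add: transpose_def)
  moreover have "0 \<le> A $ i $ i + A $ i $ j + A $ j $ i + A $ j $ j"
    using sym_pos_semidef_inner_nonneg[OF assms, of "axis i 1 + axis j 1"]
    unfolding matrix_nth_eq_inner_axis matrix_vector_right_distrib inner_simps by linarith
  moreover have "0 \<le> A $ i $ i - A $ i $ j - A $ j $ i + A $ j $ j"
    using sym_pos_semidef_inner_nonneg[OF assms, of "axis i 1 - axis j 1"]
    unfolding matrix_nth_eq_inner_axis matrix_vector_mult_diff_distrib inner_simps by linarith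
  ultimately show ?thesis by (simp add: abs_le_iff)
qed

lemma sym_pos_semidef_norm_le_trace:
  fixes A :: "real^'m^'m"
  assumes "sym_pos_semidef A"
  shows "norm A \<le> real CARD('m) * trace A"
proof -
  have "norm A \<le> (\<Sum>i\<in>UNIV. norm (A $ i))"
    unfolding norm_vec_def by (rule L2_set_le_sum) simp
  also have "\<dots> \<le> (\<Sum>i\<in>UNIV. \<Sum>j\<in>UNIV. \<bar>A $ i $ j\<bar>)"
    by (intro sum_mono norm_le_l1_cart)
  also have "\<dots> \<le> (\<Sum>i\<in>UNIV. \<Sum>j\<in>UNIV. (A $ i $ i + A $ j $ j) / 2)"
    using assms by (intro sum_mono sym_pos_semidef_abs_nth_le)
  also have "\<dots> = real CARD('m) * trace A"
    by (simp add: trace_def sum.distrib flip: sum_distrib_left sum_divide_distrib)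
  finally show ?thesis .
qed

lemma sym_pos_def_if_diff_scaleR_mat_1:
  fixes A :: "real^'m^'m"
  assumes "0 < c" and "sym_pos_semidef (A - c *\<^sub>R mat 1)"
  shows "sym_pos_def A"
  unfolding sym_pos_def_def
proof (intro conjI allI impI)
  show "transpose A = A"
    using assms by (simp add: sym_pos_semidef_def transpose_diff transpose_scalar)
  fix x :: "real^'m" assume "x \<noteq> 0"
  then have "0 < c * (x \<bullet> x)" using assms by simp
  also have "\<dots> \<le> x \<bullet> (A *v x)"
    using assms by (simp add: sym_pos_semidef_def matrix_vector_mult_diff_rdistrib
        scaleR_matrix_vector_assoc[symmetric] inner_diff_right)
  finally show "0 < x \<bullet> (A *v x)" .
qed

lemma closed_sym_pos_semidef: "closed {A. sym_pos_semidef A}"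
proof -
  have "closed {A :: real^'m^'m. transpose A = A \<and> (\<forall>x. 0 \<le> x \<bullet> (A *v x))}"
    by (intro closed_Collect_conj closed_Collect_all closed_Collect_eq closed_Collect_le
        continuous_intros)
  then show ?thesis by (simp add: sym_pos_semidef_def)
qed

lemma sym_pos_def_invertible:
  assumes "sym_pos_def A"
  shows "invertible A"
proof -
  have "inj ((*v) A)"
    using assms unfolding sym_pos_def_def
    by (subst vec.inj_iff_eq_0) (metis inner_zero_right less_irrefl)
  then show ?thesis
    using matrix_left_invertible_injective invertible_left_inverse by blast
qed

lemma sym_pos_def_matrix_inv:
  fixes A :: "real^'m^'m"
  assumes "sym_pos_def A"
  shows "sym_pos_def (matrix_inv A)"
  unfolding sym_pos_def_def
proof (intro conjI allI impI)
  note invertible = sym_pos_def_invertible[OF assms]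
  have sym: "transpose A = A" using assms by (simp add: sym_pos_def_def)
  have "transpose (matrix_inv A) ** A = mat 1"
    using arg_cong[OF matrix_inv_right[OF invertible], of transpose] by (simp add: matrix_transpose_mul sym)
  then show "transpose (matrix_inv A) = matrix_inv A"
    using matrix_inv_right[OF invertible] by (metis matrix_mul_assoc matrix_mul_lid matrix_mul_rid)
  fix x :: "real^'m" assume "x \<noteq> 0"
  have A_inv_x: "A *v (matrix_inv A *v x) = x"
    by (rule matrix_inv_right_vector[OF invertible])
  then have "matrix_inv A *v x \<noteq> 0" using \<open>x \<noteq> 0\<close> by auto
  then have "0 < (matrix_inv A *v x) \<bullet> (A *v (matrix_inv A *v x))"
    using assms unfolding sym_pos_def_def by blast
  then show "0 < x \<bullet> (matrix_inv A *v x)"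
    by (simp add: A_inv_x inner_commute)
qed

lemma sym_pos_def_trace_pos:
  fixes A :: "real^'m^'m"
  assumes "sym_pos_def A"
  shows "0 < trace A"
  unfolding trace_def
proof (intro sum_pos)
  fix i :: 'm
  have "axis i (1::real) \<noteq> 0" by (simp add: axis_eq_0_iff)
  then show "0 < A $ i $ i"
    using assms unfolding matrix_nth_eq_inner_axis sym_pos_def_def by blast
qed auto

lemma card_power2_le_trace_mult_trace_matrix_inv:
  fixes A :: "real^'m^'m"
  assumes "sym_pos_def A"
  shows "(real CARD('m))\<^sup>2 \<le> trace A * trace (matrix_inv A)"
proof -
  define t where "t = real CARD('m) / trace A"
    \<comment> \<open>the minimiser of \<open>trace (A\<^sup>-\<^sup>1) - 2 t d + t\<^sup>2 trace A\<close>, with \<open>d = CARD('m)\<close>\<close>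
  have trace_pos: "0 < trace A" by (rule sym_pos_def_trace_pos[OF assms])
  have quadratic_nonneg: "0 \<le> x \<bullet> (matrix_inv A *v x) - 2 * t * (x \<bullet> x) + t\<^sup>2 * (x \<bullet> (A *v x))" for x
  proof -
    let ?v = "matrix_inv A *v x"
    have Av: "A *v ?v = x"
      by (rule matrix_inv_right_vector[OF sym_pos_def_invertible[OF assms]])
    have "?v \<bullet> (A *v x) = x \<bullet> x"
      using assms inner_matrix_vector_mult_symmetric[of A ?v x] by (simp add: sym_pos_def_def Av)
    moreover have "0 \<le> (?v - t *\<^sub>R x) \<bullet> (A *v (?v - t *\<^sub>R x))"
      using assms by (intro sym_pos_semidef_inner_nonneg sym_pos_def_imp_semidef)
    ultimately show ?thesis
      by (simp add: matrix_vector_mult_diff_distrib matrix_vector_mult_scaleR Av inner_simps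
          power2_eq_square inner_commute algebra_simps)
  qed
  have "0 \<le> matrix_inv A $ i $ i - 2 * t + t\<^sup>2 * A $ i $ i" for i
    using quadratic_nonneg[of "axis i 1"]
    by (simp only: matrix_nth_eq_inner_axis inner_axis_axis inner_real_def mult_1_right simp_thms
        if_True)
  then have "0 \<le> (\<Sum>i\<in>UNIV. matrix_inv A $ i $ i - 2 * t + t\<^sup>2 * A $ i $ i)"
    by (intro sum_nonneg)
  also have "\<dots> = trace (matrix_inv A) - 2 * t * real CARD('m) + t\<^sup>2 * trace A"
    by (simp add: trace_def sum.distrib sum_subtractf sum_distrib_left)
  also have "\<dots> = trace (matrix_inv A) - (real CARD('m))\<^sup>2 / trace A"
    using trace_pos by (simp add: t_def power2_eq_square field_simps)
  finally show ?thesis using trace_pos by (simp add: field_simps)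
qed

definition loewner_slice :: "real \<Rightarrow> real \<Rightarrow> (real^'m^'m) set" where
  "loewner_slice c d = {S. sym_pos_semidef (S - c *\<^sub>R mat 1) \<and> trace S = d}"

lemma loewner_slice_sym_pos_def: "\<lbrakk>0 < c; S \<in> loewner_slice c d\<rbrakk> \<Longrightarrow> sym_pos_def S"
  unfolding loewner_slice_def using sym_pos_def_if_diff_scaleR_mat_1 by blast

lemma convex_loewner_slice: "convex (loewner_slice c d)"
proof (rule convexI)
  fix S T :: "real^'m^'m" and u v :: real
  assume S: "S \<in> loewner_slice c d" and T: "T \<in> loewner_slice c d"
    and uv: "0 \<le> u" "0 \<le> v" "u + v = 1"
  have "u *\<^sub>R S + v *\<^sub>R T - c *\<^sub>R mat 1 =
      u *\<^sub>R (S - c *\<^sub>R mat 1) + v *\<^sub>R (T - c *\<^sub>R mat 1) + (u + v - 1) *\<^sub>R c *\<^sub>R mat 1"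
    by (simp add: algebra_simps)
  then have "sym_pos_semidef (u *\<^sub>R S + v *\<^sub>R T - c *\<^sub>R mat 1)"
    using S T uv by (simp add: loewner_slice_def sym_pos_semidef_add sym_pos_semidef_scaleR)
  moreover have "trace (u *\<^sub>R S + v *\<^sub>R T) = d"
    using S T uv by (simp add: loewner_slice_def trace_add trace_scaleR flip: distrib_right)
  ultimately show "u *\<^sub>R S + v *\<^sub>R T \<in> loewner_slice c d"
    by (simp add: loewner_slice_def)
qed

lemma compact_loewner_slice:
  assumes "0 < c"
  shows "compact (loewner_slice c d :: (real^'m^'m) set)"
  unfolding compact_eq_bounded_closed
proof
  have "norm S \<le> real CARD('m) * d" if "S \<in> loewner_slice c d" for S :: "real^'m^'m"
    using sym_pos_semidef_norm_le_trace[of S] loewner_slice_sym_pos_def[OF assms that] that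
    by (simp add: sym_pos_def_imp_semidef loewner_slice_def)
  then show "bounded (loewner_slice c d :: (real^'m^'m) set)"
    by (rule boundedI)
  have "closed ((\<lambda>S. S - c *\<^sub>R mat 1) -` {A :: real^'m^'m. sym_pos_semidef A} \<inter> {S. trace S = d})"
    by (intro closed_Int closed_vimage closed_sym_pos_semidef closed_Collect_eq continuous_intros)
  also have "\<dots> = loewner_slice c d" by (auto simp: loewner_slice_def)
  finally show "closed (loewner_slice c d :: (real^'m^'m) set)" .
qed

lemma scaleR_trace_quotient_in_loewner_slice:
  fixes A :: "real^'m^'m"
  assumes "0 < r" and "0 \<le> d"
    and semidef: "sym_pos_semidef (A - r *\<^sub>R mat 1)" and "trace A \<le> B"
  shows "(d / trace A) *\<^sub>R A \<in> loewner_slice (r * d / B) d"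
proof -
  have trace_pos: "0 < trace A"
    using sym_pos_def_if_diff_scaleR_mat_1[OF assms(1) semidef] by (rule sym_pos_def_trace_pos)
  have "r * d / B \<le> r * d / trace A"
    using assms trace_pos by (intro divide_left_mono) auto
  moreover have "(d / trace A) *\<^sub>R A - (r * d / B) *\<^sub>R mat 1 =
      (d / trace A) *\<^sub>R (A - r *\<^sub>R mat 1) + (r * d / trace A - r * d / B) *\<^sub>R mat 1"
    by (simp add: algebra_simps)
  ultimately have "sym_pos_semidef ((d / trace A) *\<^sub>R A - (r * d / B) *\<^sub>R mat 1)"
    using assms trace_pos semidef
    by (simp add: sym_pos_semidef_add sym_pos_semidef_scaleR sym_pos_semidef_mat_1)
  then show ?thesis
    using trace_pos by (simp add: loewner_slice_def trace_scaleR)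
qed

lemma trace_normalized_map_has_fixed_point:
  fixes G :: "real^'m^'m \<Rightarrow> real^'m^'m"
  assumes "0 < r" and "0 < d"
    and cont: "continuous_on {S. sym_pos_def S \<and> trace S = d} G"
    and lower: "\<And>S. \<lbrakk>sym_pos_def S; trace S = d\<rbrakk> \<Longrightarrow> sym_pos_semidef (G S - r *\<^sub>R mat 1)"
    and upper: "\<And>S. \<lbrakk>sym_pos_def S; trace S = d\<rbrakk> \<Longrightarrow> trace (G S) \<le> B"
  obtains S where "sym_pos_def S" and "trace S = d" and "(d / trace (G S)) *\<^sub>R G S = S"
proof -
  have G_pos: "0 < trace (G S)" if "sym_pos_def S" "trace S = d" for S
    using sym_pos_def_if_diff_scaleR_mat_1[OF \<open>0 < r\<close> lower[OF that]] by (rule sym_pos_def_trace_pos)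
  define N where "N S = (d / trace (G S)) *\<^sub>R G S" for S
  define D where "D = (loewner_slice (r * d / B) d :: (real^'m^'m) set)"
  have N_in_D: "N S \<in> D" if "sym_pos_def S" "trace S = d" for S
    unfolding N_def D_def using assms(1,2) lower[OF that] upper[OF that]
    by (intro scaleR_trace_quotient_in_loewner_slice) auto
  define S0 :: "real^'m^'m" where "S0 = (d / real CARD('m)) *\<^sub>R mat 1"
  have S0: "sym_pos_def S0" "trace S0 = d"
    using \<open>0 < d\<close> by (simp_all add: S0_def sym_pos_def_def transpose_scalar trace_scaleR trace_I
        scaleR_matrix_vector_assoc[symmetric])
  have "0 < B" using G_pos[OF S0] upper[OF S0] by linarith
  then have bound_pos: "0 < r * d / B" using assms(1,2) by simp
  have D: "sym_pos_def S" "trace S = d" if "S \<in> D" for S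
    using loewner_slice_sym_pos_def[OF bound_pos] that by (auto simp: D_def loewner_slice_def)
  have "continuous_on D G"
    using D by (intro continuous_on_subset[OF cont]) auto
  then have "continuous_on D N"
    unfolding N_def using G_pos[OF D] by (intro continuous_intros) force+
  moreover have "compact D" "convex D"
    unfolding D_def by (rule compact_loewner_slice[OF bound_pos] convex_loewner_slice)+
  moreover have "D \<noteq> {}" using N_in_D[OF S0] by blast
  moreover have "N \<in> D \<rightarrow> D" using N_in_D[OF D] by blast
  ultimately obtain S where "S \<in> D" "N S = S"
    using brouwer by metis
  with D show thesis by (intro that) (auto simp: N_def)
qed

lemma sym_pos_semidef_F_map:
  assumes "sym_pos_def S" and "1 \<le> n" and "0 \<le> \<epsilon>" and "0 \<le> \<gamma>"
  shows "sym_pos_semidef (F_map n K \<epsilon> \<gamma> y S)"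
proof -
  have inv: "sym_pos_semidef (matrix_inv S)"
    using assms(1) by (intro sym_pos_def_imp_semidef sym_pos_def_matrix_inv)
  then show ?thesis
    unfolding F_map_def using assms sym_pos_semidef_trace_nonneg[OF inv]
    by (intro sym_pos_semidef_scaleR sym_pos_semidef_add sym_pos_semidef_sum
        sym_pos_semidef_outer_prod sym_pos_semidef_mat_1) (auto simp: sym_pos_semidef_def)
qed

lemma trace_F_map_le:
  fixes S :: "real^'m^'m"
  assumes "sym_pos_def S" and "1 \<le> n" and "0 < \<epsilon>" and "0 \<le> \<gamma>"
  shows "trace (F_map n K \<epsilon> \<gamma> y S) \<le>
    (real n - 1) / real K * (\<Sum>k=1..K. (y k \<bullet> y k) / \<epsilon>) + \<gamma> * trace S / real CARD('m)"
proof -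
  have inv: "sym_pos_def (matrix_inv S)" by (rule sym_pos_def_matrix_inv[OF assms(1)])
  then have quad_nonneg: "0 \<le> y k \<bullet> (matrix_inv S *v y k)" for k
    by (intro sym_pos_semidef_inner_nonneg sym_pos_def_imp_semidef)
  have trace_inv_pos: "0 < trace (matrix_inv S)" by (rule sym_pos_def_trace_pos[OF inv])
  define t where "t = (real n - 1) / real K *
      (\<Sum>k=1..K. (y k \<bullet> y k) / (y k \<bullet> (matrix_inv S *v y k) + \<epsilon>))
    + \<gamma> * real CARD('m) / trace (matrix_inv S)"
  have "0 \<le> t"
    unfolding t_def using assms quad_nonneg trace_inv_pos
    by (intro add_nonneg_nonneg mult_nonneg_nonneg sum_nonneg divide_nonneg_nonneg)
      (simp_all add: less_imp_le)
  have "trace (F_map n K \<epsilon> \<gamma> y S) = 1 / (1 + \<gamma> / (real n - 1)) * t"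
    by (simp add: F_map_def t_def trace_scaleR trace_add trace_sum trace_outer_prod trace_I)
  also have "\<dots> \<le> t"
    using \<open>0 \<le> t\<close> assms by (intro mult_left_le_one_le) (auto simp: divide_le_eq_1)
  also have "\<dots> \<le> (real n - 1) / real K * (\<Sum>k=1..K. (y k \<bullet> y k) / \<epsilon>)
      + \<gamma> * trace S / real CARD('m)"
    unfolding t_def
  proof (intro add_mono mult_left_mono sum_mono divide_left_mono)
    have "\<gamma> * (real CARD('m))\<^sup>2 \<le> \<gamma> * (trace S * trace (matrix_inv S))"
      using assms by (intro mult_left_mono card_power2_le_trace_mult_trace_matrix_inv)
    then show "\<gamma> * real CARD('m) / trace (matrix_inv S) \<le> \<gamma> * trace S / real CARD('m)"
      using trace_inv_pos by (simp add: field_simps power2_eq_square)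
  qed (use assms quad_nonneg in \<open>simp_all add: add_nonneg_pos\<close>)
  finally show ?thesis .
qed

lemma continuous_on_F_map:
  assumes "0 < \<epsilon>"
  shows "continuous_on {S. sym_pos_def S} (F_map n K \<epsilon> \<gamma> y)"
proof -
  have "y k \<bullet> (matrix_inv S *v y k) + \<epsilon> \<noteq> 0" "trace (matrix_inv S) \<noteq> 0" if "sym_pos_def S" for S k
  proof -
    have inv: "sym_pos_def (matrix_inv S)" by (rule sym_pos_def_matrix_inv[OF that])
    show "trace (matrix_inv S) \<noteq> 0"
      using sym_pos_def_trace_pos[OF inv] by simp
    show "y k \<bullet> (matrix_inv S *v y k) + \<epsilon> \<noteq> 0"
      using sym_pos_semidef_inner_nonneg[OF sym_pos_def_imp_semidef[OF inv], of "y k"] assms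
      by linarith
  qed
  then show ?thesis
    unfolding F_map_def[abs_def]
    by (intro continuous_intros) (auto simp: sym_pos_def_invertible)
qed

lemma sym_pos_semidef_M_tilde_diff:
  assumes "sym_pos_def S" and "1 \<le> n" and "0 \<le> \<epsilon>" and "\<rho> \<le> 1" and "0 \<le> \<gamma>"
  shows "sym_pos_semidef (M_tilde n K \<epsilon> \<rho> \<gamma> y S - \<rho> *\<^sub>R mat 1)"
  using assms by (simp add: M_tilde_def sym_pos_semidef_scaleR sym_pos_semidef_F_map)

lemma trace_M_tilde_le:
  fixes S :: "real^'m^'m"
  assumes "sym_pos_def S" and "1 \<le> n" and "0 < \<epsilon>" and "0 \<le> \<rho>" and "\<rho> \<le> 1" and "0 \<le> \<gamma>"
  shows "trace (M_tilde n K \<epsilon> \<rho> \<gamma> y S) \<le>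
    (real n - 1) / real K * (\<Sum>k=1..K. (y k \<bullet> y k) / \<epsilon>) + \<gamma> * trace S / real CARD('m)
      + real CARD('m)"
proof -
  let ?F = "F_map n K \<epsilon> \<gamma> y S"
  have "0 \<le> trace ?F"
    using assms by (intro sym_pos_semidef_trace_nonneg sym_pos_semidef_F_map) auto
  have "trace (M_tilde n K \<epsilon> \<rho> \<gamma> y S) = (1 - \<rho>) * trace ?F + \<rho> * real CARD('m)"
    by (simp add: M_tilde_def trace_add trace_scaleR trace_I)
  also have "\<dots> \<le> trace ?F + real CARD('m)"
    using assms \<open>0 \<le> trace ?F\<close> by (intro add_mono mult_left_le_one_le) auto
  finally show ?thesis
    using trace_F_map_le[of S n \<epsilon> \<gamma> K y] assms by linarith
qed

lemma continuous_on_M_tilde: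
  assumes "0 < \<epsilon>"
  shows "continuous_on {S. sym_pos_def S} (M_tilde n K \<epsilon> \<rho> \<gamma> y)"
  unfolding M_tilde_def[abs_def] by (intro continuous_intros continuous_on_F_map assms)

theorem theorem3:
  fixes n K :: nat and \<epsilon> \<rho> \<gamma> :: real and y :: "nat \<Rightarrow> real^'m"
  assumes "n \<ge> 2" and "CARD('m) = n - 1" and "K \<ge> 1"
    and "\<epsilon> > 0" and "0 < \<rho>" and "\<rho> \<le> 1" and "\<gamma> \<ge> 0"
    and "sym_pos_def (\<Sum>k=1..K. outer_prod (y k))"
  shows "\<exists>S :: real^'m^'m. sym_pos_def S \<and> trace S = real n - 1 \<and> M_map n K \<epsilon> \<rho> \<gamma> y S = S"
proof -
  let ?G = "M_tilde n K \<epsilon> \<rho> \<gamma> y"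
  let ?B = "(real n - 1) / real K * (\<Sum>k=1..K. (y k \<bullet> y k) / \<epsilon>) + \<gamma> + (real n - 1)"
  have "0 < real n - 1" using \<open>n \<ge> 2\<close> by simp
  moreover have "continuous_on {S. sym_pos_def S \<and> trace S = real n - 1} ?G"
    by (rule continuous_on_subset[OF continuous_on_M_tilde[OF \<open>\<epsilon> > 0\<close>]]) auto
  moreover have "sym_pos_semidef (?G S - \<rho> *\<^sub>R mat 1)" if "sym_pos_def S" for S
    using assms that by (intro sym_pos_semidef_M_tilde_diff) auto
  moreover have "trace (?G S) \<le> ?B" if "sym_pos_def S" and "trace S = real n - 1" for S
    using trace_M_tilde_le[of S n \<epsilon> \<rho> \<gamma> K y] assms that by simp
  ultimately obtain S where "sym_pos_def S" and "trace S = real n - 1"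
    and "((real n - 1) / trace (?G S)) *\<^sub>R ?G S = S"
    using trace_normalized_map_has_fixed_point[OF \<open>0 < \<rho>\<close>, of "real n - 1" ?G ?B] by blast
  then show ?thesis unfolding M_map_def by blast
qed

end
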